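(* Let $f_1,\dots,f_M:\mathbb{R}^n\to\mathbb{R}^n$, let $\mathcal{S}$ be a finite (nonempty) set, let $\{V_\alpha\}_{\alpha\in\mathcal{S}}$ be a family of functions $V_\alpha:\mathbb{R}^n\to\mathbb{R}_{\ge0}$, and let $c:\mathbb{R}^n\to\mathbb{R}_{\ge0}$. Let $\mu\ge1$ and let $t_{\gamma,\alpha,i,\beta,j}\ge0$ be real numbers, indexed by $(\gamma,\alpha,i,\beta,j)\in\mathcal{S}\times\mathcal{S}\times\{1,\dots,M\}\times\mathcal{S}\times\{1,\dots,M\}$, such that $$V_\gamma(x)\le\mu\,c(x)+V_\alpha(f_i(x))+\sum_{(\beta,j)\in\mathcal{S}\times\{1,\dots,M\}}t_{\gamma,\alpha,i,\beta,j}\bigl(V_\beta(f_j(x))-V_\alpha(f_i(x))\bigr)$$ for all $x\in\mathbb{R}^n$ and all $(\gamma,\alpha,i)\in\mathcal{S}\times\mathcal{S}\times\{1,\dots,M\}$. Then the function $V(x)=\max_{\alpha\in\mathcal{S}}V_\alpha(x)$ satisfies $$V(x)\le\mu\,c(x)+\max_{i\in\{1,\dots,M\}}V(f_i(x)),\qquad\forall x\in\mathbb{R}^n.$$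
   Context: $M\ge1$ is an integer. The maps $f_1,\dots,f_M$ are the modes of a switched system $x_{k+1}=f_{\sigma(k)}(x_k)$ with $\sigma:\mathbb{N}\to\{1,\dots,M\}$, and $c$ is its cost function. *)

theory Defs
  imports "HOL-Analysis.Analysis"
begin

end

theory Submission
  imports Defs
begin

text \<open>
  The hypothesis holds for every pair \<open>(\<alpha>, i)\<close>, so \<open>(\<alpha>, i)\<close> may be chosen depending on \<open>x\<close>: take
  a pair at which \<open>V \<alpha> (f i x)\<close> is largest. Every difference in the weighted sum is then
  nonpositive, and the nonnegative weights keep it so; the sum can be dropped. What remains bounds
  every \<open>V \<gamma> x\<close> by \<open>\<mu> * c x\<close> plus one of the values under the two maxima on the right.
\<close>

theorem proposition5:
  fixes M :: nat
    and f :: "nat \<Rightarrow> real ^ 'n \<Rightarrow> real ^ 'n"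
    and S :: "'s set"
    and V :: "'s \<Rightarrow> real ^ 'n \<Rightarrow> real"
    and c :: "real ^ 'n \<Rightarrow> real"
    and \<mu> :: real
    and t :: "'s \<Rightarrow> 's \<Rightarrow> nat \<Rightarrow> 's \<Rightarrow> nat \<Rightarrow> real"
  assumes "M \<ge> 1"
    and "finite S" and "S \<noteq> {}"
    and "\<And>\<alpha> x. \<alpha> \<in> S \<Longrightarrow> V \<alpha> x \<ge> 0"
    and "\<And>x. c x \<ge> 0"
    and "\<mu> \<ge> 1"
    and "\<And>\<gamma> \<alpha> i \<beta> j. \<gamma> \<in> S \<Longrightarrow> \<alpha> \<in> S \<Longrightarrow> i \<in> {1..M} \<Longrightarrow> \<beta> \<in> S \<Longrightarrow> j \<in> {1..M} \<Longrightarrow>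
           t \<gamma> \<alpha> i \<beta> j \<ge> 0"
    and "\<And>x \<gamma> \<alpha> i. \<gamma> \<in> S \<Longrightarrow> \<alpha> \<in> S \<Longrightarrow> i \<in> {1..M} \<Longrightarrow>
           V \<gamma> x \<le> \<mu> * c x + V \<alpha> (f i x)
             + (\<Sum>(\<beta>, j)\<in>S \<times> {1..M}. t \<gamma> \<alpha> i \<beta> j * (V \<beta> (f j x) - V \<alpha> (f i x)))"
  defines "Vmax \<equiv> (\<lambda>x. MAX \<alpha>\<in>S. V \<alpha> x)"
  shows "\<forall>x. Vmax x \<le> \<mu> * c x + (MAX i\<in>{1..M}. Vmax (f i x))"
proof
  fix x
  have fin: "finite (S \<times> {1..M})" and ne: "S \<times> {1..M} \<noteq> {}"
    using assms(1-3) by auto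
  let ?W = "(\<lambda>(\<alpha>, i). V \<alpha> (f i x)) ` (S \<times> {1..M})"
  have "Max ?W \<in> ?W"
    using fin ne by (intro Max_in) auto
  then obtain \<alpha> i where \<alpha>: "\<alpha> \<in> S" and i: "i \<in> {1..M}" and Max_W: "Max ?W = V \<alpha> (f i x)"
    by auto
  have largest: "V \<beta> (f j x) \<le> V \<alpha> (f i x)" if "\<beta> \<in> S" "j \<in> {1..M}" for \<beta> j
    unfolding Max_W[symmetric] using fin that by (intro Max_ge) auto
  have "V \<alpha> (f i x) \<le> Vmax (f i x)"
    unfolding Vmax_def using \<alpha> assms(2) by simp
  also have "\<dots> \<le> (MAX i\<in>{1..M}. Vmax (f i x))"
    using i by (intro Max_ge) auto
  finally have le_max: "V \<alpha> (f i x) \<le> (MAX i\<in>{1..M}. Vmax (f i x))" .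
  have "V \<gamma> x \<le> \<mu> * c x + (MAX i\<in>{1..M}. Vmax (f i x))" if \<gamma>: "\<gamma> \<in> S" for \<gamma>
  proof -
    have "(\<Sum>(\<beta>, j)\<in>S \<times> {1..M}. t \<gamma> \<alpha> i \<beta> j * (V \<beta> (f j x) - V \<alpha> (f i x))) \<le> 0"
      using assms(7)[OF \<gamma> \<alpha> i] largest
      by (intro sum_nonpos) (auto intro!: mult_nonneg_nonpos)
    with assms(8)[OF \<gamma> \<alpha> i, of x] le_max show ?thesis
      by linarith
  qed
  then show "Vmax x \<le> \<mu> * c x + (MAX i\<in>{1..M}. Vmax (f i x))"
    unfolding Vmax_def using assms(2,3) by simp
qed

end
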